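(* Let $g:[0,\infty)\to(0,\infty)$ be a positive, (strictly) increasing and differentiable function, let $p\in\mathbb{N}$ (so $p\ge 1$) and $q\in(0,1)$. Let $\lambda,\mu$ be positive real numbers such that $\lambda\ge\mu$. Then for all real $x,y$ with $0<x<y$, $$\frac{(1-q)^{\lambda(g(0)-g(x))}\,\Gamma_q(g(0))^\lambda}{[p]_q^{-\mu(g(0)-g(x))}\,\Gamma_{(p,q)}(g(0))^\mu}\;\ge\;\frac{\Gamma_q(g(x))^\lambda}{\Gamma_{(p,q)}(g(x))^\mu}\;\ge\;\frac{(1-q)^{\lambda(g(y)-g(x))}\,\Gamma_q(g(y))^\lambda}{[p]_q^{-\mu(g(y)-g(x))}\,\Gamma_{(p,q)}(g(y))^\mu}.$$
   Context: For $q\in(0,1)$ and real $t>0$, put $[t]_q=\frac{1-q^t}{1-q}$, and for $p\in\mathbb{N}$ put $[p]_q!=[1]_q[2]_q\cdots[p]_q$. The $q$-Gamma function is, for $t>0$, $$\Gamma_q(t)=(1-q)^{1-t}\prod_{n=0}^{\infty}\frac{1-q^{n+1}}{1-q^{n+t}}.$$ The $(p,q)$-Gamma function is, for $t>0$, $$\Gamma_{(p,q)}(t)=\frac{[p]_q^{\,t}\,[p]_q!}{[t]_q[t+1]_q\cdots[t+p]_q}.$$ *)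

theory Defs
  imports "HOL-Analysis.Analysis"
begin

definition q_number :: "real \<Rightarrow> real \<Rightarrow> real" where
  "q_number q t = (1 - q powr t) / (1 - q)"

definition q_factorial :: "real \<Rightarrow> nat \<Rightarrow> real" where
  "q_factorial q p = (\<Prod>k=1..p. q_number q (real k))"

definition q_Gamma :: "real \<Rightarrow> real \<Rightarrow> real" where
  "q_Gamma q t =
     (1 - q) powr (1 - t) * (\<Prod>n. (1 - q ^ (n + 1)) / (1 - q powr (real n + t)))"

definition pq_Gamma :: "nat \<Rightarrow> real \<Rightarrow> real \<Rightarrow> real" where
  "pq_Gamma p q t =
     q_number q (real p) powr t * q_factorial q p / (\<Prod>k=0..p. q_number q (t + real k))"

(* prodinf is unspecified on divergent products; this shows that the product
   in q_Gamma converges on the whole intended range of parameters. *)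
lemma convergent_prod_q_Gamma:
  fixes q t :: real
  assumes q: "0 < q" "q < 1" and t: "0 < t"
  shows "convergent_prod (\<lambda>n. (1 - q ^ (n + 1)) / (1 - q powr (real n + t)))"
proof -
  have conv: "convergent_prod (\<lambda>n. 1 - q powr (real n + s))" if s: "0 < s" for s
  proof -
    have eq: "q powr (real n + s) = q powr s * q ^ n" for n
      using q by (simp add: powr_add powr_realpow)
    have "q powr (real n + s) < 1" for n
      using q s powr_less_mono'[of q 0 "real n + s"] by simp
    then have "- (q powr (real n + s)) \<noteq> -1" for n
      by (metis less_irrefl neg_equal_iff_equal)
    moreover have "summable (\<lambda>n. \<bar>- (q powr (real n + s))\<bar>)"
      using q by (simp add: eq abs_mult summable_mult summable_geometric)
    ultimately have "convergent_prod (\<lambda>n. 1 + - (q powr (real n + s)))"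
      by (intro summable_imp_convergent_prod_real)
    then show ?thesis by simp
  qed
  have "q ^ (n + 1) = q powr (real n + 1)" for n
    using q by (simp add: powr_add powr_realpow)
  then show ?thesis
    using convergent_prod_divide[OF conv[of 1] conv[OF t]] by simp
qed

end

theory Submission
  imports Defs
begin

text \<open>
  Both inequalities say that one function of a single variable is decreasing. Put
  \<open>G t = (1 - q)\<^sup>t \<Gamma>\<^sub>q(t)\<close> and \<open>P t = [p]\<^sub>q\<^sup>-\<^sup>t \<Gamma>\<^sub>(\<^sub>p\<^sub>,\<^sub>q\<^sub>)(t)\<close>, which are
  \<open>scaled_q_Gamma\<close> and \<open>scaled_pq_Gamma\<close> below. The powers of \<open>1 - q\<close> and of
  \<open>[p]\<^sub>q\<close> in the statement complete the Gamma values to \<open>G\<close> and \<open>P\<close>, so that after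
  cancelling a common positive factor the claim is that
  \<open>F t = G t\<^sup>\<lambda> / P t\<^sup>\<mu>\<close> decreases along \<open>g 0 < g x < g y\<close>.

  The prefactors remove exactly the exponential part of each Gamma function, and what is left is
  a product of factors \<open>1 / (1 - q\<^sup>t\<^sup>+\<^sup>n)\<close>, each of which decreases in \<open>t\<close>: \<open>G\<close> has one such factor for
  every \<open>n \<ge> 0\<close> and \<open>P\<close> those with \<open>n \<le> p\<close>, up to constants. In \<open>G t / P t\<close> the finitely many
  factors of \<open>P\<close> cancel and a tail of the infinite product remains
  (\<open>scaled_Gamma_quotient_eq\<close>). Hence both \<open>G\<close> and \<open>G / P\<close> are positive and decreasing
  (\<open>scaled_q_Gamma_antimono\<close>, \<open>scaled_Gamma_quotient_antimono\<close>), and because \<open>\<lambda> \<ge> \<mu> > 0\<close> so is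
  \<open>F = (G / P)\<^sup>\<mu> G\<^sup>(\<^sup>\<lambda>\<^sup>-\<^sup>\<mu>\<^sup>)\<close>. Since \<open>g\<close> is increasing with positive values, evaluating \<open>F\<close> along \<open>g\<close>
  gives the two inequalities.
\<close>

definition q_Gamma_factor :: "real \<Rightarrow> real \<Rightarrow> nat \<Rightarrow> real" where
  "q_Gamma_factor q t n = (1 - q ^ (n + 1)) / (1 - q powr (real n + t))"

lemma one_minus_powr_pos:
  fixes q t :: real
  assumes "0 < q" "q < 1" "0 < t"
  shows "0 < 1 - q powr t"
  using assms powr_less_mono'[of q 0 t] by simp

lemma one_minus_power_Suc_pos:
  fixes q :: real
  assumes "0 < q" "q < 1"
  shows "0 < 1 - q ^ (n + 1)"
  using assms power_Suc_less_one[of q n] by simp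

lemma q_number_pos:
  assumes "0 < q" "q < 1" "0 < t"
  shows "0 < q_number q t"
  using one_minus_powr_pos[OF assms] assms(2) by (simp add: q_number_def)

lemma q_factorial_pos:
  assumes "0 < q" "q < 1"
  shows "0 < q_factorial q p"
  unfolding q_factorial_def using assms by (intro prod_pos) (auto intro: q_number_pos)

lemma q_Gamma_factor_pos:
  assumes "0 < q" "q < 1" "0 < t"
  shows "0 < q_Gamma_factor q t n"
  unfolding q_Gamma_factor_def
  using assms by (intro divide_pos_pos one_minus_power_Suc_pos one_minus_powr_pos) auto

lemma q_Gamma_factor_antimono:
  assumes q: "0 < q" "q < 1" and "0 < a" "a \<le> b"
  shows "q_Gamma_factor q b n \<le> q_Gamma_factor q a n"
proof -
  have "q powr (real n + b) \<le> q powr (real n + a)"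
    using assms by (intro powr_mono') auto
  moreover have "0 < 1 - q powr (real n + a)"
    using assms by (intro one_minus_powr_pos) auto
  moreover have "0 \<le> 1 - q ^ (n + 1)"
    using one_minus_power_Suc_pos[OF q, of n] by simp
  ultimately show ?thesis
    unfolding q_Gamma_factor_def by (intro divide_left_mono mult_pos_pos) auto
qed

lemma convergent_q_Gamma_factor:
  assumes "0 < q" "q < 1" "0 < t"
  shows "convergent_prod (\<lambda>n. q_Gamma_factor q t (n + m))"
proof -
  have "convergent_prod (q_Gamma_factor q t)"
    unfolding q_Gamma_factor_def[abs_def] by (rule convergent_prod_q_Gamma) fact+
  then show ?thesis by simp
qed

text \<open>
  The offset \<open>m\<close> covers the full product (\<open>m = 0\<close>), which governs \<open>G\<close>, and the tail beyond the
  factors of the \<open>(p,q)\<close>-Gamma function (\<open>m = p + 1\<close>), which governs \<open>G / P\<close>.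
\<close>

lemma prodinf_q_Gamma_factor_pos:
  assumes "0 < q" "q < 1" "0 < t"
  shows "0 < (\<Prod>n. q_Gamma_factor q t (n + m))"
  using assms by (intro less_0_prodinf convergent_q_Gamma_factor q_Gamma_factor_pos)

lemma prodinf_q_Gamma_factor_antimono:
  assumes "0 < q" "q < 1" "0 < a" "a \<le> b"
  shows "(\<Prod>n. q_Gamma_factor q b (n + m)) \<le> (\<Prod>n. q_Gamma_factor q a (n + m))"
proof (rule prodinf_le)
  show "(\<lambda>n. q_Gamma_factor q b (n + m)) has_prod (\<Prod>n. q_Gamma_factor q b (n + m))"
    "(\<lambda>n. q_Gamma_factor q a (n + m)) has_prod (\<Prod>n. q_Gamma_factor q a (n + m))"
    using assms by (auto intro!: convergent_prod_has_prod convergent_q_Gamma_factor)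
  show "0 \<le> q_Gamma_factor q b (n + m) \<and> q_Gamma_factor q b (n + m) \<le> q_Gamma_factor q a (n + m)" for n
    using q_Gamma_factor_antimono[of q a b] q_Gamma_factor_pos[of q b] assms
    by (auto intro: less_imp_le)
qed

definition scaled_q_Gamma :: "real \<Rightarrow> real \<Rightarrow> real" where
  "scaled_q_Gamma q t = (1 - q) powr t * q_Gamma q t"

definition scaled_pq_Gamma :: "nat \<Rightarrow> real \<Rightarrow> real \<Rightarrow> real" where
  "scaled_pq_Gamma p q t = q_number q (real p) powr (- t) * pq_Gamma p q t"

lemma scaled_q_Gamma_eq:
  assumes "q < 1"
  shows "scaled_q_Gamma q t = (1 - q) * (\<Prod>n. q_Gamma_factor q t n)"
proof -
  have "(1 - q) powr t * (1 - q) powr (1 - t) = 1 - q"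
    using assms by (simp flip: powr_add)
  then show ?thesis
    by (simp add: scaled_q_Gamma_def q_Gamma_def q_Gamma_factor_def flip: mult.assoc)
qed

lemma scaled_pq_Gamma_eq:
  assumes "0 < q" "q < 1" "p \<ge> 1"
  shows "scaled_pq_Gamma p q t = q_factorial q p / (\<Prod>k=0..p. q_number q (t + real k))"
proof -
  have "q_number q (real p) powr (- t) * q_number q (real p) powr t = 1"
    using q_number_pos[of q "real p"] assms by (simp flip: powr_add)
  then show ?thesis
    by (simp add: scaled_pq_Gamma_def pq_Gamma_def flip: mult.assoc)
qed

lemma scaled_q_Gamma_pos:
  assumes "0 < q" "q < 1" "0 < t"
  shows "0 < scaled_q_Gamma q t"
  using prodinf_q_Gamma_factor_pos[of q t 0] assms by (simp add: scaled_q_Gamma_eq)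

lemma scaled_q_Gamma_antimono:
  assumes "0 < q" "q < 1" "0 < a" "a \<le> b"
  shows "scaled_q_Gamma q b \<le> scaled_q_Gamma q a"
  using prodinf_q_Gamma_factor_antimono[of q a b 0] assms
  by (auto simp: scaled_q_Gamma_eq)

lemma scaled_pq_Gamma_pos:
  assumes "0 < q" "q < 1" "p \<ge> 1" "0 < t"
  shows "0 < scaled_pq_Gamma p q t"
  using assms
  by (auto simp: scaled_pq_Gamma_eq intro!: divide_pos_pos prod_pos q_factorial_pos q_number_pos)

text \<open>
  The first \<open>p + 1\<close> factors of the infinite product have the denominators \<open>1 - q\<^sup>t\<^sup>+\<^sup>k\<close>,
  which are those of the \<open>(p,q)\<close>-Gamma function up to the constant \<open>1 - q\<close>. Dividing cancels
  them, and only the constant \<open>C\<close> and the tail of the product are left.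
\<close>

lemma scaled_Gamma_quotient_eq:
  assumes q: "0 < q" "q < 1" and p: "p \<ge> 1"
  obtains C where "C > 0"
    "\<And>t. 0 < t \<Longrightarrow>
      scaled_q_Gamma q t / scaled_pq_Gamma p q t = C * (\<Prod>n. q_Gamma_factor q t (n + (p + 1)))"
proof
  define K where "K = (\<Prod>k<p + 1. (1 - q ^ (k + 1)) / (1 - q))"
  have K: "K > 0"
    unfolding K_def using q by (intro prod_pos ballI divide_pos_pos one_minus_power_Suc_pos) auto
  then show "(1 - q) * K / q_factorial q p > 0"
    using q by (simp add: q_factorial_pos)
  fix t :: real assume t: "0 < t"
  define D where "D = (\<Prod>k=0..p. q_number q (t + real k))"
  have D: "D > 0"
    unfolding D_def using q t by (intro prod_pos) (auto intro: q_number_pos)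
  have "q_Gamma_factor q t k * q_number q (t + real k) = (1 - q ^ (k + 1)) / (1 - q)" for k
    using one_minus_powr_pos[of q "t + real k"] q t
    by (simp add: q_Gamma_factor_def q_number_def add.commute[of "real k"])
  moreover have index: "{..<p + 1} = {0..p}" by auto
  ultimately have "(\<Prod>k<p + 1. q_Gamma_factor q t k) * D = K"
    unfolding K_def D_def index prod.distrib[symmetric] by (intro prod.cong) auto
  then have head: "(\<Prod>k<p + 1. q_Gamma_factor q t k) = K / D"
    using D by (simp add: eq_divide_eq del: prod.lessThan_Suc)
  have "q_Gamma_factor q t k \<noteq> 0" for k
    using q_Gamma_factor_pos[of q t k] q t by simp
  then have "(\<Prod>n. q_Gamma_factor q t n) = (\<Prod>n. q_Gamma_factor q t (n + (p + 1))) * (K / D)"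
    using prodinf_split_initial_segment[of "q_Gamma_factor q t" "p + 1"]
      convergent_q_Gamma_factor[of q t 0] q t head by simp
  then show "scaled_q_Gamma q t / scaled_pq_Gamma p q t
      = (1 - q) * K / q_factorial q p * (\<Prod>n. q_Gamma_factor q t (n + (p + 1)))"
    using q p D by (simp add: scaled_q_Gamma_eq scaled_pq_Gamma_eq flip: D_def)
qed

lemma scaled_Gamma_quotient_antimono:
  assumes "0 < q" "q < 1" "p \<ge> 1" "0 < a" "a \<le> b"
  shows "scaled_q_Gamma q b / scaled_pq_Gamma p q b \<le> scaled_q_Gamma q a / scaled_pq_Gamma p q a"
proof -
  obtain C where "C > 0" "\<And>t. 0 < t \<Longrightarrow>
      scaled_q_Gamma q t / scaled_pq_Gamma p q t = C * (\<Prod>n. q_Gamma_factor q t (n + (p + 1)))"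
    using scaled_Gamma_quotient_eq[OF assms(1-3)] by blast
  then show ?thesis
    using prodinf_q_Gamma_factor_antimono[of q a b "p + 1"] assms by (simp del: add_Suc_right)
qed

text \<open>
  Here \<open>\<lambda> \<ge> \<mu>\<close> is used: splitting \<open>G\<^sup>\<lambda> / P\<^sup>\<mu>\<close> as \<open>(G / P)\<^sup>\<mu> G\<^sup>(\<^sup>\<lambda>\<^sup>-\<^sup>\<mu>\<^sup>)\<close> gives nonnegative powers
  of decreasing functions.
\<close>

lemma scaled_Gamma_powr_quotient_antimono:
  assumes q: "0 < q" "q < 1" and p: "p \<ge> 1" and "0 \<le> mu" "mu \<le> lam" and ab: "0 < a" "a \<le> b"
  shows "scaled_q_Gamma q b powr lam / scaled_pq_Gamma p q b powr mu
       \<le> scaled_q_Gamma q a powr lam / scaled_pq_Gamma p q a powr mu"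
proof -
  have split: "scaled_q_Gamma q t powr lam / scaled_pq_Gamma p q t powr mu
      = (scaled_q_Gamma q t / scaled_pq_Gamma p q t) powr mu * scaled_q_Gamma q t powr (lam - mu)"
    if "0 < t" for t
    using scaled_q_Gamma_pos[OF q that] scaled_pq_Gamma_pos[OF q p that]
    by (simp add: powr_divide powr_diff)
  have b: "0 < b" using ab by simp
  have "(scaled_q_Gamma q b / scaled_pq_Gamma p q b) powr mu
      \<le> (scaled_q_Gamma q a / scaled_pq_Gamma p q a) powr mu"
    using scaled_Gamma_quotient_antimono[OF q p ab] assms
      scaled_q_Gamma_pos[OF q b] scaled_pq_Gamma_pos[OF q p b]
    by (intro powr_mono2) auto
  moreover have "scaled_q_Gamma q b powr (lam - mu) \<le> scaled_q_Gamma q a powr (lam - mu)"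
    using scaled_q_Gamma_antimono[OF q ab] scaled_q_Gamma_pos[OF q b] assms
    by (intro powr_mono2) auto
  ultimately show ?thesis
    unfolding split[OF ab(1)] split[OF b] by (intro mult_mono) auto
qed

text \<open>
  The prefactors carry exponents relative to a base point \<open>v\<close>; this isolates the positive
  factor that depends on \<open>v\<close> alone. At \<open>u = v\<close> the prefactors equal one, so that the middle term
  of the theorem has this form as well.
\<close>

lemma Gamma_powr_quotient_scaled:
  assumes q: "0 < q" "q < 1" and p: "p \<ge> 1" and u: "0 < u"
  shows "((1 - q) powr (lam * (u - v)) * q_Gamma q u powr lam)
           / (q_number q (real p) powr (- mu * (u - v)) * pq_Gamma p q u powr mu)
       = (1 - q) powr (- lam * v) * q_number q (real p) powr (- mu * v)
           * (scaled_q_Gamma q u powr lam / scaled_pq_Gamma p q u powr mu)"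
proof -
  let ?N = "q_number q (real p)"
  have N: "?N > 0"
    using q p by (intro q_number_pos) auto
  have "q_Gamma q u > 0"
    using scaled_q_Gamma_pos[OF q u] q by (simp add: scaled_q_Gamma_def zero_less_mult_iff)
  then have G: "scaled_q_Gamma q u powr lam = (1 - q) powr (lam * u) * q_Gamma q u powr lam"
    using q by (simp add: scaled_q_Gamma_def powr_mult powr_powr mult.commute)
  have "pq_Gamma p q u > 0"
    using scaled_pq_Gamma_pos[OF q p u] N by (simp add: scaled_pq_Gamma_def zero_less_mult_iff)
  then have P: "scaled_pq_Gamma p q u powr mu = ?N powr (- mu * u) * pq_Gamma p q u powr mu"
    using N by (simp add: scaled_pq_Gamma_def powr_mult powr_powr mult.commute)
  have 1: "(1 - q) powr (lam * (u - v)) = (1 - q) powr (- lam * v) * (1 - q) powr (lam * u)"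
    using q by (simp add: algebra_simps flip: powr_add)
  have "?N powr (- mu * (u - v)) = ?N powr (- mu * u) / ?N powr (- mu * v)"
    by (simp add: algebra_simps flip: powr_diff)
  then show ?thesis
    unfolding G P 1 using N by simp
qed

theorem theorem2p5:
  fixes g :: "real \<Rightarrow> real" and p :: nat and q lam mu x y :: real
  assumes g_pos: "\<And>t. t \<ge> 0 \<Longrightarrow> g t > 0"
    and g_incr: "strict_mono_on {0..} g"
    and g_diff: "g differentiable_on {0..}"
    and p: "p \<ge> 1"
    and q: "0 < q" "q < 1"
    and lm: "lam > 0" "mu > 0" "lam \<ge> mu"
    and xy: "0 < x" "x < y"
  shows "((1 - q) powr (lam * (g 0 - g x)) * q_Gamma q (g 0) powr lam)
           / (q_number q (real p) powr (- mu * (g 0 - g x)) * pq_Gamma p q (g 0) powr mu)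
         \<ge> q_Gamma q (g x) powr lam / pq_Gamma p q (g x) powr mu
       \<and> q_Gamma q (g x) powr lam / pq_Gamma p q (g x) powr mu
         \<ge> ((1 - q) powr (lam * (g y - g x)) * q_Gamma q (g y) powr lam)
           / (q_number q (real p) powr (- mu * (g y - g x)) * pq_Gamma p q (g y) powr mu)"
proof -
  let ?F = "\<lambda>u v. ((1 - q) powr (lam * (u - v)) * q_Gamma q u powr lam)
           / (q_number q (real p) powr (- mu * (u - v)) * pq_Gamma p q u powr mu)"
  have antimono: "?F b v \<le> ?F a v" if ab: "0 < a" "a \<le> b" for a b v
  proof -
    have "0 < b" using ab by simp
    then show ?thesis
      unfolding Gamma_powr_quotient_scaled[OF q p ab(1)] Gamma_powr_quotient_scaled[OF q p \<open>0 < b\<close>]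
      using lm by (intro mult_left_mono scaled_Gamma_powr_quotient_antimono q p ab) auto
  qed
  have "g 0 \<le> g x" "g x \<le> g y"
    using strict_mono_onD[OF g_incr, of 0 x] strict_mono_onD[OF g_incr, of x y] xy by auto
  moreover have "g 0 > 0" "g x > 0"
    using g_pos xy by auto
  moreover have "?F (g x) (g x) = q_Gamma q (g x) powr lam / pq_Gamma p q (g x) powr mu"
    using q q_number_pos[of q "real p"] p by simp
  ultimately show ?thesis
    using antimono[of "g 0" "g x" "g x"] antimono[of "g x" "g y" "g x"] by metis
qed

end
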